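(* Let $m_H,m_L\ge 1$ be integers, $m=m_H+m_L$, let $0<\sigma_L^2\le\sigma_H^2$, let $p>0$ and let $r^*\ge 0$ be a real number. For a labelled constellation $\mathbf{z}\in\mathbb{C}^{2^m}$ let $r_H(\mathbf{z})$, $r_L(\mathbf{z})$ be the BICM-SIC rates over the AWGN channels with noise parameters $\sigma_H^2$ and $\sigma_L^2$, and let $\mathbb{E}[\|Z\|^2]$ be the average power of $\mathbf{z}$ (all defined in the context). Consider the optimization problem $$\max_{\mathbf{z}\in\mathbb{C}^{2^m}} r_L(\mathbf{z})\quad\text{subject to}\quad r_H(\mathbf{z})\ge r^*,\quad \mathbb{E}[\|Z\|^2]\le p.$$ Then the constraint $\mathbb{E}[\|Z\|^2]\le p$ is equivalent to the constraint $\mathbb{E}[\|Z\|^2]=p$, in the sense that the problem above and the problem obtained from it by replacing $\mathbb{E}[\|Z\|^2]\le p$ with $\mathbb{E}[\|Z\|^2]=p$ have the same optimal value: $$\sup\{r_L(\mathbf{z}): r_H(\mathbf{z})\ge r^*,\ \mathbb{E}[\|Z\|^2]\le p\}=\sup\{r_L(\mathbf{z}): r_H(\mathbf{z})\ge r^*,\ \mathbb{E}[\|Z\|^2]=p\},$$ where the supremum of the empty set is $-\infty$.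
   Context: A hierarchical constellation of order $2^m$, $m=m_H+m_L$, is a vector $\mathbf{z}\in\mathbb{C}^{2^m}$ whose entries are indexed by binary labels $(\mathbf{b}_H,\mathbf{b}_L)\in\{0,1\}^{m_H}\times\{0,1\}^{m_L}$ (the labelling is fixed; entries with different labels are allowed to coincide). The entry with label $(\mathbf{b}_H,\mathbf{b}_L)$ is the transmitted symbol for the high-priority bits $\mathbf{b}_H=(b_H^1,\dots,b_H^{m_H})$ and low-priority bits $\mathbf{b}_L=(b_L^1,\dots,b_L^{m_L})$. Let $(\mathbf{B}_H,\mathbf{B}_L)$ be uniformly distributed on $\{0,1\}^{m_H}\times\{0,1\}^{m_L}$ (so all bits are independent and uniform), and let $Z$ be the entry of $\mathbf{z}$ with label $(\mathbf{B}_H,\mathbf{B}_L)$. The average power of the constellation is $\mathbb{E}[\|Z\|^2]=2^{-m}\sum_{k}|z_k|^2$. The received signals are $Y_H=Z+N_H$ and $Y_L=Z+N_L$, where $N_H,N_L$ are circularly symmetric complex Gaussian noises independent of $(\mathbf{B}_H,\mathbf{B}_L)$; the channel transition density (with respect to Lebesgue measure on $\mathbb{C}\cong\mathbb{R}^2$) is $p(y|z)=\frac{1}{2\pi\sigma^2}e^{-\|y-z\|^2/(2\sigma^2)}$, with $\sigma^2=\sigma_H^2$ for $Y_H$ and $\sigma^2=\sigma_L^2$ for $Y_L$. The BICM-SIC rates (bit-interleaved coded modulation with successive interference cancellation) are $$r_H(\mathbf{z})=\sum_{i=1}^{m_H} I(B_H^i;Y_H),\qquad r_L(\mathbf{z})=\sum_{j=1}^{m_L}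 I(B_L^j;Y_L\mid\mathbf{B}_H),$$ where $I(\cdot\,;\cdot)$ and $I(\cdot\,;\cdot\mid\cdot)$ denote mutual information and conditional mutual information in base 2. *)

theory Defs
  imports "HOL-Probability.Probability"
begin

text \<open>
  Bit labels of the high- and the low-priority stream are vectors \<open>bool ^ 'h\<close> and
  \<open>bool ^ 'l\<close>, so that \<open>m\<^sub>H = CARD('h) \<ge> 1\<close> and \<open>m\<^sub>L = CARD('l) \<ge> 1\<close>.
  A labelled constellation is an arbitrary complex vector with one entry per label, of
  dimension \<open>2 ^ (m\<^sub>H + m\<^sub>L)\<close>.
\<close>

type_synonym ('h, 'l) label = "(bool ^ 'h) \<times> (bool ^ 'l)"
type_synonym ('h, 'l) constellation = "complex ^ ('h, 'l) label"

definition avg_power :: "('h::finite, 'l::finite) constellation \<Rightarrow> real" where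
  "avg_power z = measure_pmf.expectation (pmf_of_set UNIV) (\<lambda>b. (norm (z $ b))\<^sup>2)"

text \<open>The parameter \<open>v\<close> is the noise parameter \<open>\<sigma>\<^sup>2\<close>, not \<open>\<sigma>\<close>; it is
  the variance of each of the two real components of the noise.\<close>

definition awgn_density :: "real \<Rightarrow> complex \<Rightarrow> complex \<Rightarrow> real" where
  "awgn_density v z y = 1 / (2 * pi * v) * exp (- (norm (y - z))\<^sup>2 / (2 * v))"

definition noise :: "real \<Rightarrow> complex measure" where
  "noise v = density lborel (awgn_density v 0)"

text \<open>
  The sample space of a receiver with noise parameter \<open>v\<close> consists of the pairs
  \<open>((b\<^sub>H, b\<^sub>L), n)\<close> of a uniformly distributed label and an independent noise value. Every
  rate involves only one of the two receivers, so the joint law of the two noises is irrelevant.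
\<close>

definition bicm_space :: "real \<Rightarrow> (('h::finite, 'l::finite) label \<times> complex) measure" where
  "bicm_space v = measure_pmf (pmf_of_set UNIV) \<Otimes>\<^sub>M noise v"

definition high_bits :: "('h::finite, 'l::finite) label \<times> complex \<Rightarrow> bool ^ 'h" where
  "high_bits \<omega> = fst (fst \<omega>)"

definition low_bits :: "('h::finite, 'l::finite) label \<times> complex \<Rightarrow> bool ^ 'l" where
  "low_bits \<omega> = snd (fst \<omega>)"

definition received ::
    "('h::finite, 'l::finite) constellation \<Rightarrow> ('h, 'l) label \<times> complex \<Rightarrow> complex" where
  "received z \<omega> = z $ fst \<omega> + snd \<omega>"

definition rate_H :: "real \<Rightarrow> ('h::finite, 'l::finite) constellation \<Rightarrow> real" where
  "rate_H v z = (\<Sum>i\<in>UNIV.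
     prob_space.mutual_information (bicm_space v) 2 (count_space UNIV) borel
       (\<lambda>\<omega>. high_bits \<omega> $ i) (received z))"

text \<open>The library defines \<open>I(X; Y | Z)\<close> by the chain rule, as \<open>I(X; (Y, Z)) - I(X; Z)\<close>.\<close>

definition rate_L :: "real \<Rightarrow> ('h::finite, 'l::finite) constellation \<Rightarrow> real" where
  "rate_L v z = (\<Sum>j\<in>UNIV.
     prob_space.conditional_mutual_information (bicm_space v) 2
       (count_space UNIV) borel (count_space UNIV)
       (\<lambda>\<omega>. low_bits \<omega> $ j) (received z) high_bits)"

text \<open>The locale constants above are specified only on probability spaces, so
  their use rests on \<open>prob_space_bicm_space\<close>.\<close>

lemma prob_space_noise:
  assumes "v > 0"
  shows "prob_space (noise v)"
proof (rule prob_spaceI)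
  have m: "awgn_density v 0 \<in> borel_measurable borel"
    unfolding awgn_density_def by measurable
  have fact: "ennreal (awgn_density v 0 y)
      = (\<Prod>b\<in>Basis. ennreal (normal_density 0 (sqrt v) (y \<bullet> b)))" for y :: complex
  proof -
    have "exp (- (norm y)\<^sup>2 / (2 * v)) = exp (- (Re y)\<^sup>2 / (2 * v)) * exp (- (Im y)\<^sup>2 / (2 * v))"
      by (simp add: cmod_power2 mult_exp_exp add_divide_distrib diff_divide_distrib)
    moreover have "sqrt (2 * pi * v) * sqrt (2 * pi * v) = 2 * pi * v"
      using assms by simp
    ultimately have "awgn_density v 0 y
        = normal_density 0 (sqrt v) (Re y) * normal_density 0 (sqrt v) (Im y)"
      using assms by (simp add: awgn_density_def normal_density_def)
    then show ?thesis
      by (simp add: Basis_complex_def ennreal_mult)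
  qed
  have one: "(\<integral>\<^sup>+x. ennreal (normal_density 0 (sqrt v) x) \<partial>lborel) = 1"
    using prob_space.emeasure_space_1[OF prob_space_normal_density[of "sqrt v" 0]] assms
    by (simp add: emeasure_density)
  have "emeasure (noise v) (space (noise v)) = (\<integral>\<^sup>+y. ennreal (awgn_density v 0 y) \<partial>lborel)"
    using m by (simp add: noise_def emeasure_density)
  also have "\<dots> = (\<Prod>b\<in>(Basis::complex set). \<integral>\<^sup>+x. ennreal (normal_density 0 (sqrt v) x) \<partial>lborel)"
    unfolding fact by (rule nn_integral_lborel_prod) auto
  also have "\<dots> = 1"
    by (simp add: one)
  finally show "emeasure (noise v) (space (noise v)) = 1" .
qed

lemma prob_space_bicm_space:
  assumes "v > 0"
  shows "prob_space (bicm_space v :: (('h::finite, 'l::finite) label \<times> complex) measure)"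
proof -
  interpret N: prob_space "noise v"
    using assms by (rule prob_space_noise)
  interpret P: pair_prob_space
    "measure_pmf (pmf_of_set UNIV) :: ('h, 'l) label measure" "noise v" ..
  show ?thesis
    unfolding bicm_space_def by (rule P.prob_space_axioms)
qed

lemma bicm_random_variables:
  fixes z :: "('h::finite, 'l::finite) constellation"
  shows "high_bits \<in> (bicm_space v :: (('h, 'l) label \<times> complex) measure) \<rightarrow>\<^sub>M count_space UNIV"
    and "low_bits \<in> (bicm_space v :: (('h, 'l) label \<times> complex) measure) \<rightarrow>\<^sub>M count_space UNIV"
    and "received z \<in> (bicm_space v :: (('h, 'l) label \<times> complex) measure) \<rightarrow>\<^sub>M borel"
proof -
  have [measurable_cong]: "sets (noise v) = sets borel"
    by (simp add: noise_def)
  show "high_bits \<in> (bicm_space v :: (('h, 'l) label \<times> complex) measure) \<rightarrow>\<^sub>M count_space UNIV"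
    unfolding high_bits_def[abs_def] bicm_space_def
    by (rule measurable_compose[OF measurable_fst]) simp
  show "low_bits \<in> (bicm_space v :: (('h, 'l) label \<times> complex) measure) \<rightarrow>\<^sub>M count_space UNIV"
    unfolding low_bits_def[abs_def] bicm_space_def
    by (rule measurable_compose[OF measurable_fst]) simp
  have "(\<lambda>\<omega>. z $ fst \<omega>) \<in> (bicm_space v :: (('h, 'l) label \<times> complex) measure) \<rightarrow>\<^sub>M borel"
    unfolding bicm_space_def by (rule measurable_compose[OF measurable_fst]) simp
  moreover have "snd \<in> (bicm_space v :: (('h, 'l) label \<times> complex) measure) \<rightarrow>\<^sub>M borel"
    unfolding bicm_space_def by measurable
  ultimately show "received z \<in> (bicm_space v :: (('h, 'l) label \<times> complex) measure) \<rightarrow>\<^sub>M borel"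
    unfolding received_def[abs_def] by (rule borel_measurable_add)
qed

lemma avg_power_eq:
  fixes z :: "('h::finite, 'l::finite) constellation"
  shows "avg_power z = (\<Sum>b\<in>UNIV. (norm (z $ b))\<^sup>2) / 2 ^ (CARD('h) + CARD('l))"
proof -
  have "card (UNIV :: ('h, 'l) label set) = 2 ^ (CARD('h) + CARD('l))"
    by (simp add: power_add UNIV_Times_UNIV[symmetric] card_cartesian_product del: UNIV_Times_UNIV)
  then show ?thesis
    by (simp add: avg_power_def integral_pmf_of_set)
qed

end

theory Submission
  imports Defs
begin

text \<open>
  Every constellation \<open>z\<close> of power at most \<open>p\<close> is \<open>\<beta> z'\<close> with
  \<open>0 \<le> \<beta> \<le> 1\<close> and \<open>z'\<close> of power exactly \<open>p\<close> (with \<open>\<beta> = 0\<close> when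
  \<open>z = 0\<close>). If \<open>Y'\<close> is received from \<open>z'\<close> and \<open>N\<close> is an independent copy of the noise,
  then \<open>\<beta> Y' + \<surd>(1 - \<beta>\<^sup>2) N\<close> has the same joint law with the label as the signal received
  from \<open>z\<close>. So \<open>z\<close> sees a degraded version of the channel of \<open>z'\<close>, and data processing
  shows that neither rate of \<open>z\<close> exceeds that of \<open>z'\<close>. For the conditional rate, data processing is
  applied to \<open>I(B\<^sub>L\<^sup>j; (Y, B\<^sub>H))\<close>; the subtracted term \<open>I(B\<^sub>L\<^sup>j; B\<^sub>H)\<close> does not depend on
  the constellation.
\<close>

section \<open>Data processing for the Kullback-Leibler divergence\<close>

text \<open>Let \<open>D\<close> be the density of the image of \<open>density P f\<close> with
  respect to the image of \<open>P\<close>. If \<open>D * log D\<close> is integrable, change of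
  variables turns the left divergence into the integral of \<open>f x * log b (D (g x))\<close> over
  \<open>P\<close>. As \<open>D (g x)\<close> is itself a probability density over \<open>P\<close>,
  Gibbs' inequality bounds this by the integral of \<open>f x * log b (f x)\<close>, the right
  divergence. Note that \<open>KL_divergence\<close> takes the reference measure first.\<close>

lemma KL_divergence_distr_le:
  fixes f :: "'a \<Rightarrow> real"
  assumes b: "1 < b" and "prob_space P" and "prob_space (density P f)"
    and f [measurable]: "f \<in> borel_measurable P" and f_nonneg: "\<And>x. 0 \<le> f x"
    and int: "integrable P (\<lambda>x. f x * log b (f x))"
    and g [measurable]: "g \<in> P \<rightarrow>\<^sub>M T"
  shows "KL_divergence b (distr P T g) (distr (density P f) T g) \<le> KL_divergence b P (density P f)"
proof -
  interpret P: prob_space P by fact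
  interpret Q: prob_space "density P f" by fact
  interpret PI: information_space P b by standard fact
  let ?P = "distr P T g" and ?Q = "distr (density P f) T g"
  have [measurable]: "g \<in> density P f \<rightarrow>\<^sub>M T" by simp
  interpret P': prob_space ?P by (rule P.prob_space_distr) simp
  interpret Q': prob_space ?Q by (rule Q.prob_space_distr) simp
  have ac: "absolutely_continuous ?P ?Q"
    unfolding absolutely_continuous_def
  proof
    fix A assume A: "A \<in> null_sets ?P"
    then have "AE x in P. x \<notin> g -` A \<inter> space P"
      by (intro AE_not_in) (simp add: null_sets_distr_iff)
    then have "AE x in P. g x \<in> A \<longrightarrow> f x = 0"
      using AE_space by eventually_elim auto
    then show "A \<in> null_sets ?Q"
      using A by (auto simp: null_sets_distr_iff null_sets_density_iff)
  qed
  have "finite_measure ?Q" by (rule Q'.finite_measure_axioms)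
  \<comment> \<open>Positivity of \<open>D\<close> almost everywhere under \<open>?Q\<close>
    suffices: Gibbs' inequality takes the logarithm of \<open>D (g x)\<close> with nonzero weight
    only where \<open>f x > 0\<close>.\<close>
  from P'.real_RN_deriv[OF this ac] obtain D where D [measurable]: "D \<in> borel_measurable ?P"
    and RN: "AE x in ?P. RN_deriv ?P ?Q x = ennreal (D x)"
    and D_pos: "AE x in ?Q. 0 < D x" and D_nonneg: "\<And>x. 0 \<le> D x"
    by auto
  have [measurable]: "D \<in> borel_measurable T" using D by simp
  have Q_eq: "?Q = density ?P D"
  proof -
    have "?Q = density ?P (RN_deriv ?P ?Q)"
      using ac by (intro P'.density_RN_deriv[symmetric]) auto
    also have "\<dots> = density ?P D"
      using RN by (intro density_cong) auto
    finally show ?thesis .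
  qed
  have KL_Q: "KL_divergence b P (density P f) = (\<integral>x. f x * log b (f x) \<partial>P)"
    using b f_nonneg by (intro P.KL_density) auto
  have KL_Q': "KL_divergence b ?P ?Q = (\<integral>x. D x * log b (D x) \<partial>?P)"
    unfolding Q_eq using b D_nonneg by (intro P'.KL_density) auto
  show ?thesis
  proof (cases "integrable ?P (\<lambda>x. D x * log b (D x))")
    case False
    \<comment> \<open>The Bochner integral of a non-integrable function is 0, so the left side is 0 here.\<close>
    then have "KL_divergence b ?P ?Q = 0"
      unfolding KL_Q' by (rule not_integrable_integral_eq)
    moreover have "0 \<le> KL_divergence b P (density P f)"
      using PI.KL_nonneg[OF assms(3) f _ int] f_nonneg by simp
    ultimately show ?thesis by simp
  next
    case True
    have log_Q: "integrable ?Q (\<lambda>x. log b (D x))"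
      using True D_nonneg unfolding Q_eq by (subst integrable_real_density) auto
    then have "integrable (density P f) (\<lambda>x. log b (D (g x)))"
      by (subst (asm) integrable_distr_eq) auto
    then have int_flog: "integrable P (\<lambda>x. f x * log b (D (g x)))"
      using f_nonneg by (subst (asm) integrable_real_density) auto
    have "integrable P f"
      using integrable_real_density[OF f _ borel_measurable_const[of 1]] f_nonneg by simp
    moreover have "(\<integral>x. f x \<partial>P) = 1"
      using integral_real_density[OF f _ borel_measurable_const[of 1]] f_nonneg
        Q.prob_space by simp
    moreover have "integrable ?P D"
      using integrable_real_density[OF D _ borel_measurable_const[of 1]] D_nonneg
        Q'.integrable_const[of "1::real"] unfolding Q_eq by simp
    then have "integrable P (\<lambda>x. D (g x))"
      by (subst (asm) integrable_distr_eq) auto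
    moreover have "(\<integral>x. D x \<partial>?P) = 1"
      using integral_real_density[OF D _ borel_measurable_const[of 1]] D_nonneg
        Q'.prob_space unfolding Q_eq by simp
    then have "(\<integral>x. D (g x) \<partial>P) = 1"
      by (subst (asm) integral_distr) auto
    ultimately have normal: "integrable P (\<lambda>x. (f x - D (g x)) / ln b)"
      "(\<integral>x. (f x - D (g x)) / ln b \<partial>P) = 0"
      by auto
    have "(\<integral>x. D x * log b (D x) \<partial>?P) = (\<integral>x. log b (D x) \<partial>?Q)"
      unfolding Q_eq using D_nonneg by (subst integral_real_density) auto
    also have "\<dots> = (\<integral>x. f x * log b (D (g x)) \<partial>P)"
      using f_nonneg by (subst integral_distr) (auto simp: integral_real_density)
    also have "\<dots> = (\<integral>x. f x * log b (D (g x)) + (f x - D (g x)) / ln b \<partial>P)"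
      using normal int_flog by simp
    also have "\<dots> \<le> (\<integral>x. f x * log b (f x) \<partial>P)"
      \<comment> \<open>Gibbs' inequality \<open>u ln w + (u - w) \<le> u ln u\<close> pointwise, where the added terms
        \<open>u - w\<close> have integral 0.\<close>
    proof (rule integral_mono_AE)
      have "AE x in density P f. 0 < D (g x)"
        using D_pos by (subst (asm) AE_distr_iff) auto
      then have "AE x in P. 0 < f x \<longrightarrow> 0 < D (g x)"
        by (simp add: AE_density)
      then show "AE x in P. f x * log b (D (g x)) + (f x - D (g x)) / ln b \<le> f x * log b (f x)"
      proof eventually_elim
        fix x assume pos: "0 < f x \<longrightarrow> 0 < D (g x)"
        have "f x * ln (D (g x)) + (f x - D (g x)) \<le> f x * ln (f x)"
        proof (cases "f x = 0")
          case True
          then show ?thesis using D_nonneg by simp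
        next
          case False
          then have *: "0 < f x" "0 < D (g x)" using pos f_nonneg[of x] by auto
          then have "ln (D (g x)) - ln (f x) \<le> D (g x) / f x - 1"
            using ln_le_minus_one[of "D (g x) / f x"] by (simp add: ln_div)
          from mult_left_mono[OF this, of "f x"] * show ?thesis
            by (simp add: algebra_simps)
        qed
        then show "f x * log b (D (g x)) + (f x - D (g x)) / ln b \<le> f x * log b (f x)"
          using b by (simp add: log_def divide_right_mono flip: add_divide_distrib)
      qed
    qed (use int normal int_flog in auto)
    finally show ?thesis
      unfolding KL_Q KL_Q' .
  qed
qed

text \<open>A noisy channel is modelled as a deterministic map \<open>g\<close> of the input and
  independent randomness \<open>R\<close>. Adjoining \<open>R\<close> to both measures leaves the
  divergence unchanged, because the density becomes \<open>f (fst w)\<close> and the first marginal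
  of the product is \<open>P\<close>; then the deterministic case applies.\<close>

lemma KL_divergence_randomized_le:
  fixes f :: "'a \<Rightarrow> real"
  assumes b: "1 < b" and "prob_space P" and "prob_space (density P f)" and "prob_space R"
    and f [measurable]: "f \<in> borel_measurable P" and f_nonneg: "\<And>x. 0 \<le> f x"
    and int: "integrable P (\<lambda>x. f x * log b (f x))"
    and g: "g \<in> P \<Otimes>\<^sub>M R \<rightarrow>\<^sub>M T"
  shows "KL_divergence b (distr (P \<Otimes>\<^sub>M R) T g) (distr (density P f \<Otimes>\<^sub>M R) T g)
    \<le> KL_divergence b P (density P f)"
proof -
  interpret P: prob_space P by fact
  interpret Q: prob_space "density P f" by fact
  interpret R: prob_space R by fact
  interpret PR: pair_prob_space P R ..
  interpret QR: pair_prob_space "density P f" R ..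
  \<comment> \<open>Writing \<open>R\<close> as a density with constant value 1 makes the product
    formula for densities applicable.\<close>
  have "density P f \<Otimes>\<^sub>M density R (\<lambda>_. 1) = density (P \<Otimes>\<^sub>M R) (\<lambda>(x, y). ennreal (f x) * 1)"
    by (rule pair_measure_density) (auto simp: density_1 R.sigma_finite_measure_axioms)
  then have prod: "density P f \<Otimes>\<^sub>M R = density (P \<Otimes>\<^sub>M R) (\<lambda>w. ennreal (f (fst w)))"
    by (simp add: density_1 case_prod_beta')
  have fst_eq: "integral\<^sup>L (P \<Otimes>\<^sub>M R) (\<lambda>w. h (fst w)) = integral\<^sup>L P h"
    if "h \<in> borel_measurable P" for h :: "'a \<Rightarrow> real"
    using that R.distr_pair_fst[of P] integral_distr[OF measurable_fst that, of R] by simp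
  have "integrable (P \<Otimes>\<^sub>M R) (\<lambda>w. f (fst w) * log b (f (fst w)))"
    using int R.distr_pair_fst[of P] by (subst (asm) R.distr_pair_fst[of P, symmetric])
      (subst (asm) integrable_distr_eq, auto)
  moreover have "prob_space (density (P \<Otimes>\<^sub>M R) (\<lambda>w. ennreal (f (fst w))))"
    unfolding prod[symmetric] by (rule QR.prob_space_axioms)
  ultimately have "KL_divergence b (distr (P \<Otimes>\<^sub>M R) T g) (distr (density P f \<Otimes>\<^sub>M R) T g)
      \<le> KL_divergence b (P \<Otimes>\<^sub>M R) (density (P \<Otimes>\<^sub>M R) (\<lambda>w. ennreal (f (fst w))))"
    unfolding prod using f_nonneg g
    by (intro KL_divergence_distr_le b PR.prob_space_axioms) auto
  also have "\<dots> = (\<integral>w. f (fst w) * log b (f (fst w)) \<partial>(P \<Otimes>\<^sub>M R))"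
    using b f_nonneg by (intro PR.KL_density) auto
  also have "\<dots> = (\<integral>x. f x * log b (f x) \<partial>P)"
    by (rule fst_eq) simp
  also have "\<dots> = KL_divergence b P (density P f)"
    using b f_nonneg by (intro P.KL_density[symmetric]) auto
  finally show ?thesis .
qed

section \<open>Bounded densities and integrability of the information density\<close>

text \<open>Domination gives absolute continuity and bounds the Radon-Nikodym derivative almost
  everywhere. Truncating the derivative at \<bar>C\<bar> changes it only on a null set and makes the
  bound hold everywhere.\<close>

lemma bounded_density_exists:
  assumes "prob_space P" and "prob_space Q" and sets: "sets Q = sets P"
    and le: "\<And>A. A \<in> sets P \<Longrightarrow> emeasure Q A \<le> ennreal C * emeasure P A"
  obtains f where "f \<in> borel_measurable P" and "\<And>x. 0 \<le> f x" and "\<And>x. f x \<le> \<bar>C\<bar>"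
    and "Q = density P (\<lambda>x. ennreal (f x))"
proof -
  interpret P: prob_space P by fact
  interpret Q: prob_space Q by fact
  have ac: "absolutely_continuous P Q"
    unfolding absolutely_continuous_def
  proof
    fix A assume A: "A \<in> null_sets P"
    then have "emeasure Q A = 0" using le[of A] by (simp add: null_setsD1 null_setsD2)
    then show "A \<in> null_sets Q" using A sets by auto
  qed
  have "finite_measure Q" by (rule Q.finite_measure_axioms)
  from P.real_RN_deriv[OF this ac sets] obtain D where D [measurable]: "D \<in> borel_measurable P"
    and RN: "AE x in P. RN_deriv P Q x = ennreal (D x)" and D_nonneg: "\<And>x. 0 \<le> D x"
    by auto
  have "Q = density P (RN_deriv P Q)"
    using ac sets by (intro P.density_RN_deriv[symmetric])
  also have "\<dots> = density P D"
    using RN by (intro density_cong) auto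
  finally have Q: "Q = density P D" .
  \<comment> \<open>On \<open>A\<close> the derivative exceeds the bound, whereas \<open>le\<close>
    makes the integral of the excess over \<open>A\<close> at most 0. A nonnegative function with
    such an integral vanishes almost everywhere, so \<open>A\<close> is null.\<close>
  define A where "A = {x \<in> space P. \<bar>C\<bar> < D x}"
  have A [measurable]: "A \<in> sets P" unfolding A_def by simp
  have int: "integrable P D"
    using integrable_real_density[OF D _ borel_measurable_const[of 1]] D_nonneg
        Q.integrable_const[of "1::real"] unfolding Q by simp
  have "measure Q A = (\<integral>x. D x * indicator A x \<partial>P)"
    unfolding Q using D_nonneg integral_real_density[OF D, of "indicator A"]
    by (simp add: Q[symmetric] sets_eq_imp_space_eq[OF sets] sets.Int_space_eq1[of A P])
  moreover have "measure Q A \<le> \<bar>C\<bar> * measure P A"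
  proof -
    have "emeasure Q A \<le> ennreal C * emeasure P A" by (rule le) simp
    also have "\<dots> \<le> ennreal \<bar>C\<bar> * emeasure P A" by (intro mult_right_mono) auto
    finally show ?thesis
      by (simp add: P.emeasure_eq_measure Q.emeasure_eq_measure flip: ennreal_mult)
  qed
  ultimately have le0: "(\<integral>x. (D x - \<bar>C\<bar>) * indicator A x \<partial>P) \<le> 0"
    using Bochner_Integration.integral_diff[OF integrable_real_mult_indicator[OF A int]
        integrable_real_mult_indicator[OF A P.integrable_const[of "\<bar>C\<bar>"]]]
    by (simp add: left_diff_distrib sets.Int_space_eq1)
  have int': "integrable P (\<lambda>x. (D x - \<bar>C\<bar>) * indicator A x)"
    using int by (intro integrable_real_mult_indicator) auto
  have nonneg: "0 \<le> (D x - \<bar>C\<bar>) * indicator A x" for x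
    by (auto simp: A_def indicator_def)
  have "(\<integral>x. (D x - \<bar>C\<bar>) * indicator A x \<partial>P) = 0"
    using le0 nonneg by (intro antisym) auto
  then have "AE x in P. (D x - \<bar>C\<bar>) * indicator A x = 0"
    using integral_nonneg_eq_0_iff_AE[OF int'] nonneg by simp
  then have "AE x in P. D x = min (D x) \<bar>C\<bar>"
    using AE_space by eventually_elim (auto simp: A_def indicator_def split: if_splits)
  then have "Q = density P (\<lambda>x. ennreal (min (D x) \<bar>C\<bar>))"
    unfolding Q by (intro density_cong) auto
  then show thesis
    using that[of "\<lambda>x. min (D x) \<bar>C\<bar>"] D_nonneg by auto
qed

text \<open>A bounded measurable function is integrable over a finite measure. For u in (0, C], the
  inequality ln t \<le> t - 1 at t = u gives u ln u \<le> C^2, and at t = 1/u it gives u ln u \<ge>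
  -1; this is the origin of the constant \<open>1 + C * C\<close>.\<close>

lemma integrable_bounded_mult_log:
  fixes f :: "'a \<Rightarrow> real"
  assumes "finite_measure P" and b: "1 < b" and f [measurable]: "f \<in> borel_measurable P"
    and "\<And>x. 0 \<le> f x" and "\<And>x. f x \<le> C"
  shows "integrable P (\<lambda>x. f x * log b (f x))"
proof -
  interpret finite_measure P by fact
  have "\<bar>f x * ln (f x)\<bar> \<le> 1 + C * C" for x
  proof (cases "f x = 0")
    case False
    then have pos: "0 < f x" using assms(4)[of x] by simp
    have "f x * ln (f x) \<le> f x * (f x - 1)"
      using pos by (intro mult_left_mono ln_le_minus_one) auto
    also have "\<dots> \<le> f x * f x" using pos by (simp add: algebra_simps)
    also have "\<dots> \<le> C * C" using pos assms(5)[of x] by (intro mult_mono) auto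
    finally have "f x * ln (f x) \<le> C * C" .
    moreover have "f x * - ln (f x) \<le> f x * (1 / f x - 1)"
      using pos ln_le_minus_one[of "1 / f x"] by (intro mult_left_mono) (auto simp: ln_div)
    then have "- (f x * ln (f x)) \<le> 1" using pos by (simp add: algebra_simps)
    moreover have "0 \<le> C * C" by simp
    ultimately show ?thesis by linarith
  qed simp
  then have "integrable P (\<lambda>x. f x * ln (f x))"
    by (intro integrable_const_bound[of _ "1 + C * C"]) auto
  then show ?thesis by (simp add: log_def)
qed

section \<open>Mutual information under a degraded observation\<close>

text \<open>A component independent of the rest is carried along unchanged while the others are
  processed. Tonelli's theorem gives equality on rectangles, which determine the product measure. It
  is applied both to the product of marginals in the mutual information and to the label beside the
  mixed noise.\<close>

lemma pair_measure_distr_assoc: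
  assumes "prob_space A" and "prob_space B" and "prob_space R" and g [measurable]: "g \<in> B \<Otimes>\<^sub>M R \<rightarrow>\<^sub>M T"
  shows "distr ((A \<Otimes>\<^sub>M B) \<Otimes>\<^sub>M R) (A \<Otimes>\<^sub>M T) (\<lambda>w. (fst (fst w), g (snd (fst w), snd w)))
    = A \<Otimes>\<^sub>M distr (B \<Otimes>\<^sub>M R) T g"
proof -
  interpret A: prob_space A by fact
  interpret B: prob_space B by fact
  interpret R: prob_space R by fact
  interpret BR: pair_prob_space B R ..
  interpret AB: pair_prob_space A B ..
  interpret T: prob_space "distr (B \<Otimes>\<^sub>M R) T g" by (rule BR.prob_space_distr) simp
  show ?thesis
  proof (rule pair_measure_eqI[symmetric])
    fix E F assume E: "E \<in> sets A" and "F \<in> sets (distr (B \<Otimes>\<^sub>M R) T g)"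
    then have F: "F \<in> sets T" by simp
    define G where "G = g -` F \<inter> space (B \<Otimes>\<^sub>M R)"
    have G: "G \<in> sets (B \<Otimes>\<^sub>M R)" unfolding G_def using F by measurable
    have slice: "Pair (x, u) -` {((x, u), n). x \<in> E \<and> (u, n) \<in> G}
        = (if x \<in> E then Pair u -` G else {})" for x u by auto
    have m: "{((x, u), n). x \<in> E \<and> (u, n) \<in> G} \<in> sets ((A \<Otimes>\<^sub>M B) \<Otimes>\<^sub>M R)"
    proof -
      have "{((x, u), n). x \<in> E \<and> (u, n) \<in> G} = (\<lambda>w. (fst (fst w), (snd (fst w), snd w))) -` (E \<times> G)
          \<inter> space ((A \<Otimes>\<^sub>M B) \<Otimes>\<^sub>M R)"
        using sets.sets_into_space[OF E] sets.sets_into_space[OF G]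
        by (auto simp: space_pair_measure)
      also have "\<dots> \<in> sets ((A \<Otimes>\<^sub>M B) \<Otimes>\<^sub>M R)"
        using E G by (intro measurable_sets[of _ _ "A \<Otimes>\<^sub>M (B \<Otimes>\<^sub>M R)"]) auto
      finally show ?thesis .
    qed
    have "emeasure (distr ((A \<Otimes>\<^sub>M B) \<Otimes>\<^sub>M R) (A \<Otimes>\<^sub>M T) (\<lambda>w. (fst (fst w), g (snd (fst w), snd w)))) (E \<times> F)
        = emeasure ((A \<Otimes>\<^sub>M B) \<Otimes>\<^sub>M R) {((x, u), n). x \<in> E \<and> (u, n) \<in> G}"
      using E F sets.sets_into_space[OF E]
      by (subst emeasure_distr) (auto simp: G_def space_pair_measure intro!: arg_cong2[where f=emeasure])
    also have "\<dots> = (\<integral>\<^sup>+w. emeasure R (Pair w -` {((x, u), n). x \<in> E \<and> (u, n) \<in> G}) \<partial>(A \<Otimes>\<^sub>M B))"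
      by (rule R.emeasure_pair_measure_alt[OF m])
    also have "\<dots> = (\<integral>\<^sup>+x. \<integral>\<^sup>+u. emeasure R (Pair (x, u) -` {((x, u), n). x \<in> E \<and> (u, n) \<in> G}) \<partial>B \<partial>A)"
      by (rule B.nn_integral_fst[symmetric]) (rule R.measurable_emeasure_Pair[OF m])
    also have "\<dots> = (\<integral>\<^sup>+x. emeasure (B \<Otimes>\<^sub>M R) G * indicator E x \<partial>A)"
      by (intro nn_integral_cong)
        (auto simp: slice R.emeasure_pair_measure_alt[OF G] vimage_def split: split_indicator)
    also have "\<dots> = emeasure A E * emeasure (B \<Otimes>\<^sub>M R) G"
      using E by (subst nn_integral_cmult_indicator) (simp_all add: mult.commute)
    finally show "emeasure A E * emeasure (distr (B \<Otimes>\<^sub>M R) T g) F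
      = emeasure (distr ((A \<Otimes>\<^sub>M B) \<Otimes>\<^sub>M R) (A \<Otimes>\<^sub>M T) (\<lambda>w. (fst (fst w), g (snd (fst w), snd w)))) (E \<times> F)"
      using F by (simp add: emeasure_distr G_def)
  qed (auto simp: A.sigma_finite_measure_axioms T.sigma_finite_measure_axioms)
qed

text \<open>For finite-valued \<open>X\<close> the joint law has a bounded density over the product
  of its marginals. If P(X = x) > 0, then P(X = x, U \<in> B) \<le> P(U \<in> B), which is 1 / P(X =
  x) times the product of the two probabilities. Values of probability 0 contribute nothing to
  either measure, and nothing to the constant, since \<open>inverse 0 = 0\<close>.\<close>

lemma (in prob_space) joint_distr_le_product:
  fixes X :: "'a \<Rightarrow> 'x::finite"
  assumes X [measurable]: "X \<in> M \<rightarrow>\<^sub>M count_space UNIV" and U [measurable]: "U \<in> M \<rightarrow>\<^sub>M T"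
    and A: "A \<in> sets (count_space UNIV \<Otimes>\<^sub>M T)"
  shows "emeasure (distr M (count_space UNIV \<Otimes>\<^sub>M T) (\<lambda>\<omega>. (X \<omega>, U \<omega>))) A
    \<le> ennreal (\<Sum>x\<in>UNIV. inverse (prob {\<omega> \<in> space M. X \<omega> = x}))
      * emeasure (distr M (count_space UNIV) X \<Otimes>\<^sub>M distr M T U) A"
    (is "?Q A \<le> ennreal ?C * ?P A")
proof -
  define p where "p x = prob {\<omega> \<in> space M. X \<omega> = x}" for x
  define B where "B x = Pair x -` A" for x
  have B [measurable]: "B x \<in> sets T" for x
    unfolding B_def using A by (rule sets_Pair1)
  define q where "q x = prob {\<omega> \<in> space M. U \<omega> \<in> B x}" for x
  have p_nonneg: "0 \<le> p x" and q_nonneg: "0 \<le> q x" for x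
    by (simp_all add: p_def q_def)
  interpret T: prob_space "distr M T U" by (rule prob_space_distr) fact
  have q: "emeasure (distr M T U) (B x) = ennreal (q x)" for x
    by (simp add: q_def emeasure_distr emeasure_eq_measure vimage_def Int_def conj_commute)
  have A': "A \<in> sets (distr M (count_space UNIV) X \<Otimes>\<^sub>M distr M T U)"
    using A by (simp cong: sets_pair_measure_cong)
  have "?P A = (\<integral>\<^sup>+x. emeasure (distr M T U) (B x) \<partial>distr M (count_space UNIV) X)"
    unfolding B_def by (rule T.emeasure_pair_measure_alt[OF A'])
  also have "\<dots> = (\<integral>\<^sup>+\<omega>. ennreal (q (X \<omega>)) \<partial>M)"
    by (subst nn_integral_distr) (auto simp: q)
  also have "\<dots> = (\<integral>\<^sup>+\<omega>. (\<Sum>x\<in>UNIV. ennreal (q x) * indicator {\<omega> \<in> space M. X \<omega> = x} \<omega>) \<partial>M)"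
  proof (intro nn_integral_cong)
    fix \<omega> assume "\<omega> \<in> space M"
    then have "(\<Sum>x\<in>UNIV. ennreal (q x) * indicator {\<omega> \<in> space M. X \<omega> = x} \<omega>)
        = (\<Sum>x\<in>UNIV. if x = X \<omega> then ennreal (q x) else 0)"
      by (intro sum.cong) (auto simp: indicator_def)
    then show "ennreal (q (X \<omega>)) = (\<Sum>x\<in>UNIV. ennreal (q x) * indicator {\<omega> \<in> space M. X \<omega> = x} \<omega>)"
      by simp
  qed
  also have "\<dots> = (\<Sum>x\<in>UNIV. ennreal (q x) * emeasure M {\<omega> \<in> space M. X \<omega> = x})"
    by (subst nn_integral_sum) (auto simp: nn_integral_cmult_indicator)
  also have "\<dots> = ennreal (\<Sum>x\<in>UNIV. q x * p x)"
    using p_nonneg q_nonneg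
    by (simp add: emeasure_eq_measure p_def[symmetric] ennreal_mult[symmetric] sum_ennreal)
  finally have P: "?P A = ennreal (\<Sum>x\<in>UNIV. q x * p x)" .
  have "?Q A = emeasure M {\<omega> \<in> space M. U \<omega> \<in> B (X \<omega>)}"
    using A by (subst emeasure_distr) (auto simp: B_def intro!: arg_cong2[where f=emeasure])
  also have "{\<omega> \<in> space M. U \<omega> \<in> B (X \<omega>)} = (\<Union>x\<in>UNIV. {\<omega> \<in> space M. X \<omega> = x \<and> U \<omega> \<in> B x})"
    by auto
  also have "emeasure M \<dots> \<le> (\<Sum>x\<in>UNIV. emeasure M {\<omega> \<in> space M. X \<omega> = x \<and> U \<omega> \<in> B x})"
    by (rule emeasure_subadditive_finite) auto
  also have "\<dots> = ennreal (\<Sum>x\<in>UNIV. prob {\<omega> \<in> space M. X \<omega> = x \<and> U \<omega> \<in> B x})"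
    by (simp add: emeasure_eq_measure sum_ennreal)
  also have "\<dots> \<le> ennreal (?C * (\<Sum>x\<in>UNIV. q x * p x))"
  proof (intro ennreal_leI)
    have "prob {\<omega> \<in> space M. X \<omega> = x \<and> U \<omega> \<in> B x} \<le> ?C * (q x * p x)" for x
    proof (cases "p x = 0")
      case True
      have "prob {\<omega> \<in> space M. X \<omega> = x \<and> U \<omega> \<in> B x} \<le> p x"
        unfolding p_def by (rule finite_measure_mono) auto
      then show ?thesis using True by (simp add: measure_le_0_iff)
    next
      case False
      have "prob {\<omega> \<in> space M. X \<omega> = x \<and> U \<omega> \<in> B x} \<le> q x"
        unfolding q_def by (rule finite_measure_mono) auto
      also have "\<dots> = inverse (p x) * (q x * p x)"
        using False by simp
      also have "\<dots> \<le> ?C * (q x * p x)"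
        using p_nonneg q_nonneg unfolding p_def[symmetric]
        by (intro mult_right_mono member_le_sum) auto
      finally show ?thesis .
    qed
    then show "(\<Sum>x\<in>UNIV. prob {\<omega> \<in> space M. X \<omega> = x \<and> U \<omega> \<in> B x}) \<le> ?C * (\<Sum>x\<in>UNIV. q x * p x)"
      unfolding sum_distrib_left by (intro sum_mono)
  qed
  also have "\<dots> = ennreal ?C * ?P A"
    unfolding P using p_nonneg q_nonneg
    by (intro ennreal_mult) (auto intro!: sum_nonneg mult_nonneg_nonneg simp: p_def[symmetric])
  finally show ?thesis .
qed

text \<open>Degradedness is expressed by a coupling: \<open>h\<close> preserves the law on
  \<open>M\<close>, fixes \<open>X\<close> and turns \<open>V\<close> into \<open>g\<close> of
  \<open>U\<close> and fresh randomness. Hence (X, V) has the law of (X, g(U, N)) with N independent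
  of (X, U). The joint law and the product of marginals then arise from those of (X, U), each times
  \<open>R\<close>, through the same map \<open>?g\<close>, so randomized data processing
  applies.\<close>

lemma (in prob_space) mutual_information_degraded_le:
  fixes X :: "'a \<Rightarrow> 'x::finite"
  assumes b: "1 < b" and "prob_space R"
    and X [measurable]: "X \<in> M \<rightarrow>\<^sub>M count_space UNIV" and U [measurable]: "U \<in> M \<rightarrow>\<^sub>M T"
    and V [measurable]: "V \<in> M \<rightarrow>\<^sub>M T'"
    and g [measurable]: "g \<in> T \<Otimes>\<^sub>M R \<rightarrow>\<^sub>M T'" and h [measurable]: "h \<in> M \<Otimes>\<^sub>M R \<rightarrow>\<^sub>M M"
    and h_distr: "distr (M \<Otimes>\<^sub>M R) M h = M"
    and X_h: "\<And>\<omega> n. X (h (\<omega>, n)) = X \<omega>" and V_h: "\<And>\<omega> n. V (h (\<omega>, n)) = g (U \<omega>, n)"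
  shows "mutual_information b (count_space UNIV) T' X V \<le> mutual_information b (count_space UNIV) T X U"
proof -
  interpret R: prob_space R by fact
  interpret MR: pair_prob_space M R ..
  let ?S = "count_space UNIV :: 'x measure"
  let ?P = "distr M ?S X \<Otimes>\<^sub>M distr M T U"
  let ?Q = "distr M (?S \<Otimes>\<^sub>M T) (\<lambda>\<omega>. (X \<omega>, U \<omega>))"
  let ?g = "\<lambda>w. (fst (fst w), g (snd (fst w), snd w))"
  interpret PX: prob_space "distr M ?S X" by (rule prob_space_distr) fact
  interpret PU: prob_space "distr M T U" by (rule prob_space_distr) fact
  interpret P: pair_prob_space "distr M ?S X" "distr M T U" ..
  interpret Q: prob_space ?Q by (rule prob_space_distr) simp
  have sets_P: "sets ?P = sets (?S \<Otimes>\<^sub>M T)" by (intro sets_pair_measure_cong) simp_all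
  \<comment> \<open>The bound on \<open>f\<close> is what makes \<open>f * log f\<close> integrable,
    as data processing for the divergence requires.\<close>
  obtain f C where f [measurable]: "f \<in> borel_measurable ?P" and f_nonneg: "\<And>w. 0 \<le> f w"
    and f_le: "\<And>w. f w \<le> \<bar>C\<bar>" and Q_eq: "?Q = density ?P (\<lambda>w. ennreal (f w))"
  proof (rule bounded_density_exists[OF P.prob_space_axioms Q.prob_space_axioms])
    show "emeasure ?Q A \<le> ennreal (\<Sum>x\<in>UNIV. inverse (prob {\<omega> \<in> space M. X \<omega> = x})) * emeasure ?P A"
      if "A \<in> sets ?P" for A
      using that unfolding sets_P by (intro joint_distr_le_product X U)
  qed (use sets_P in auto)
  have [measurable_cong]: "sets ?P = sets (?S \<Otimes>\<^sub>M T)" by (fact sets_P)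
  have V_eq: "distr M T' V = distr (distr M T U \<Otimes>\<^sub>M R) T' g"
  proof -
    have "distr M T' V = distr (distr (M \<Otimes>\<^sub>M R) M h) T' V"
      by (simp add: h_distr)
    also have "\<dots> = distr (M \<Otimes>\<^sub>M R) T' (\<lambda>w. g (U (fst w), snd w))"
      by (subst distr_distr) (auto intro!: distr_cong simp: V_h)
    also have "\<dots> = distr (distr (M \<Otimes>\<^sub>M R) (T \<Otimes>\<^sub>M R) (\<lambda>(\<omega>, n). (U \<omega>, n))) T' g"
      by (subst distr_distr) (auto intro!: distr_cong)
    also have "distr (M \<Otimes>\<^sub>M R) (T \<Otimes>\<^sub>M R) (\<lambda>(\<omega>, n). (U \<omega>, n)) = distr M T U \<Otimes>\<^sub>M R"
      using pair_measure_distr[OF U, of "\<lambda>n. n" R R] R.sigma_finite_measure_axioms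
      by (simp add: distr_id)
    finally show ?thesis .
  qed
  have P': "distr M ?S X \<Otimes>\<^sub>M distr M T' V = distr (?P \<Otimes>\<^sub>M R) (?S \<Otimes>\<^sub>M T') ?g"
  proof -
    have "distr (?P \<Otimes>\<^sub>M R) (distr M ?S X \<Otimes>\<^sub>M T') ?g = distr M ?S X \<Otimes>\<^sub>M distr M T' V"
      unfolding V_eq
      by (intro pair_measure_distr_assoc PX.prob_space_axioms PU.prob_space_axioms assms(2)) simp
    moreover have "distr (?P \<Otimes>\<^sub>M R) (distr M ?S X \<Otimes>\<^sub>M T') ?g = distr (?P \<Otimes>\<^sub>M R) (?S \<Otimes>\<^sub>M T') ?g"
      by (intro distr_cong sets_pair_measure_cong) auto
    ultimately show ?thesis by simp
  qed
  have Q': "distr M (?S \<Otimes>\<^sub>M T') (\<lambda>\<omega>. (X \<omega>, V \<omega>)) = distr (?Q \<Otimes>\<^sub>M R) (?S \<Otimes>\<^sub>M T') ?g"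
  proof -
    have "?Q \<Otimes>\<^sub>M R = distr (M \<Otimes>\<^sub>M R) ((?S \<Otimes>\<^sub>M T) \<Otimes>\<^sub>M R) (\<lambda>(\<omega>, n). ((X \<omega>, U \<omega>), n))"
      using pair_measure_distr[of "\<lambda>\<omega>. (X \<omega>, U \<omega>)" M "?S \<Otimes>\<^sub>M T" "\<lambda>n. n" R R]
        R.sigma_finite_measure_axioms by (simp add: distr_id)
    then have "distr (?Q \<Otimes>\<^sub>M R) (?S \<Otimes>\<^sub>M T') ?g
        = distr (M \<Otimes>\<^sub>M R) (?S \<Otimes>\<^sub>M T') (\<lambda>w. (X (fst w), g (U (fst w), snd w)))"
      by (simp add: distr_distr comp_def case_prod_beta')
    \<comment> \<open>The pair of \<open>X\<close> and the processed \<open>U\<close> is the pair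
      (X, V) composed with \<open>h\<close>, so invariance of \<open>M\<close> under
      \<open>h\<close> removes the extra randomness.\<close>
    also have "\<dots> = distr (distr (M \<Otimes>\<^sub>M R) M h) (?S \<Otimes>\<^sub>M T') (\<lambda>\<omega>. (X \<omega>, V \<omega>))"
      by (subst distr_distr) (auto intro!: distr_cong simp: V_h X_h)
    finally show ?thesis by (simp add: h_distr)
  qed
  have "KL_divergence b (distr (?P \<Otimes>\<^sub>M R) (?S \<Otimes>\<^sub>M T') ?g) (distr (density ?P f \<Otimes>\<^sub>M R) (?S \<Otimes>\<^sub>M T') ?g)
      \<le> KL_divergence b ?P (density ?P f)"
  proof (rule KL_divergence_randomized_le[OF b P.prob_space_axioms _ assms(2) f f_nonneg])
    show "prob_space (density ?P f)"
      unfolding Q_eq[symmetric] by (rule Q.prob_space_axioms)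
    show "integrable ?P (\<lambda>w. f w * log b (f w))"
      using P.finite_measure_axioms b f f_nonneg f_le by (rule integrable_bounded_mult_log)
  qed simp
  then show ?thesis
    unfolding mutual_information_def P' Q' Q_eq .
qed

section \<open>Sums of independent complex Gaussians\<close>

lemma awgn_density_measurable [measurable]: "awgn_density v c \<in> borel_measurable borel"
  unfolding awgn_density_def by measurable

lemma sets_noise [measurable_cong, simp]: "sets (noise v) = sets borel"
  and space_noise [simp]: "space (noise v) = UNIV"
  by (simp_all add: noise_def)

text \<open>Translation invariance of Lebesgue measure reduces this to mean 0, where
  \<open>prob_space_noise\<close> applies.\<close>

lemma nn_integral_awgn_density:
  assumes "0 < v"
  shows "(\<integral>\<^sup>+y. ennreal (awgn_density v c y) \<partial>lborel) = 1"
proof -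
  interpret N: prob_space "noise v" using assms by (rule prob_space_noise)
  have "(\<integral>\<^sup>+y. ennreal (awgn_density v c y) \<partial>lborel)
      = (\<integral>\<^sup>+y. ennreal (awgn_density v c (c + y)) \<partial>lborel)"
    by (subst lborel_distr_plus[of c, symmetric]) (simp add: nn_integral_distr)
  also have "\<dots> = (\<integral>\<^sup>+y. ennreal (awgn_density v 0 y) \<partial>lborel)"
    by (simp add: awgn_density_def)
  also have "\<dots> = 1"
    using N.emeasure_space_1 by (simp add: noise_def emeasure_density)
  finally show ?thesis .
qed

text \<open>The left side is the joint density of n and y = \<beta> n + s n' for independent noises
  n, n'; the factor 1/s^2 is the Jacobian of a scaling by s in two real dimensions. The right side
  is the marginal density of y times the conditional density of n given y, a Gaussian of mean
  \<beta> y and parameter s^2 v.\<close>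

lemma awgn_density_complete_square:
  assumes "0 < v" and "0 < s" and unit: "\<beta>\<^sup>2 + s\<^sup>2 = 1"
  shows "awgn_density v 0 n * (awgn_density v 0 ((y - of_real \<beta> * n) / of_real s) / s\<^sup>2)
    = awgn_density v 0 y * awgn_density (s\<^sup>2 * v) (of_real \<beta> * y) n"
proof -
  \<comment> \<open>By \<open>unit\<close>, both sides equal |n|^2 + |y|^2 - 2 \<beta> (n \<bullet>
    y), an expression symmetric in n and y.\<close>
  have "s\<^sup>2 * (norm n)\<^sup>2 + (norm (y - of_real \<beta> * n))\<^sup>2
      = s\<^sup>2 * (norm y)\<^sup>2 + (norm (n - of_real \<beta> * y))\<^sup>2"
  proof -
    have \<beta>: "\<beta>\<^sup>2 = 1 - s\<^sup>2" using unit by simp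
    have "s\<^sup>2 * a\<^sup>2 + (c - \<beta> * a)\<^sup>2 = s\<^sup>2 * c\<^sup>2 + (a - \<beta> * c)\<^sup>2" for a c :: real
      by (simp add: power2_diff power_mult_distrib \<beta> algebra_simps)
    from this[of "Re n" "Re y"] this[of "Im n" "Im y"] show ?thesis
      by (simp add: cmod_power2 distrib_left)
  qed
  then have "(norm n)\<^sup>2 + (norm (y - of_real \<beta> * n))\<^sup>2 / s\<^sup>2
      = (norm y)\<^sup>2 + (norm (n - of_real \<beta> * y))\<^sup>2 / s\<^sup>2"
    using assms(2) by (simp add: field_simps)
  then have "- (norm n)\<^sup>2 / (2 * v) + - (norm (y - of_real \<beta> * n))\<^sup>2 / s\<^sup>2 / (2 * v)
      = - (norm y)\<^sup>2 / (2 * v) + - (norm (n - of_real \<beta> * y))\<^sup>2 / s\<^sup>2 / (2 * v)"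
    using assms(1) by (simp add: field_simps)
  then have "exp (- (norm n)\<^sup>2 / (2 * v)) * exp (- (norm (y - of_real \<beta> * n))\<^sup>2 / s\<^sup>2 / (2 * v))
      = exp (- (norm y)\<^sup>2 / (2 * v)) * exp (- (norm (n - of_real \<beta> * y))\<^sup>2 / s\<^sup>2 / (2 * v))"
    by (simp only: exp_add[symmetric])
  then show ?thesis
    using assms(1,2)
    by (simp add: awgn_density_def norm_divide power_divide field_simps)
qed

text \<open>Stability of the Gaussian: the joint density of the first noise and the combination is
  factored by completing the square, and the first noise is integrated out.\<close>

lemma distr_noise_combination:
  assumes v: "0 < v" and s: "0 < s" and unit: "\<beta>\<^sup>2 + s\<^sup>2 = 1"
  shows "distr (noise v \<Otimes>\<^sub>M noise v) borel (\<lambda>w. of_real \<beta> * fst w + of_real s * snd w) = noise v"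
    (is "distr ?N borel ?g = _")
proof (rule measure_eqI)
  interpret N: prob_space "noise v" using v by (rule prob_space_noise)
  fix A assume "A \<in> sets (distr ?N borel ?g)"
  then have A [measurable]: "A \<in> sets borel" by simp
  \<comment> \<open>For fixed n this substitutes y = \<beta> n + s n'; here s > 0 is
    essential.\<close>
  have inner: "(\<integral>\<^sup>+n'. indicator A (of_real \<beta> * n + of_real s * n') \<partial>noise v)
      = (\<integral>\<^sup>+y. ennreal (awgn_density v 0 ((y - of_real \<beta> * n) / of_real s) / s\<^sup>2) * indicator A y \<partial>lborel)"
    for n :: complex
  proof -
    have "(\<integral>\<^sup>+y. ennreal (awgn_density v 0 ((y - of_real \<beta> * n) / of_real s) / s\<^sup>2) * indicator A y \<partial>lborel)
      = (\<integral>\<^sup>+n'. ennreal (s\<^sup>2) * (ennreal (awgn_density v 0 n' / s\<^sup>2)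
          * indicator A (of_real \<beta> * n + of_real s * n')) \<partial>lborel)"
      using s
      by (subst lborel_affine[of s "of_real \<beta> * n"])
        (simp_all add: nn_integral_density nn_integral_distr scaleR_conv_of_real)
    also have "\<dots> = (\<integral>\<^sup>+n'. ennreal (awgn_density v 0 n')
          * indicator A (of_real \<beta> * n + of_real s * n') \<partial>lborel)"
      using s v by (simp add: mult.assoc[symmetric] ennreal_mult[symmetric] awgn_density_def)
    also have "\<dots> = (\<integral>\<^sup>+n'. indicator A (of_real \<beta> * n + of_real s * n') \<partial>noise v)"
      unfolding noise_def by (subst nn_integral_density) auto
    finally show ?thesis by simp
  qed
  have "emeasure (distr ?N borel ?g) A = (\<integral>\<^sup>+w. indicator A (?g w) \<partial>?N)"
    using nn_integral_distr[of ?g ?N borel "indicator A"] by simp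
  also have "\<dots> = (\<integral>\<^sup>+n. \<integral>\<^sup>+n'. indicator A (of_real \<beta> * n + of_real s * n') \<partial>noise v \<partial>noise v)"
    by (subst N.nn_integral_fst[symmetric]) simp_all
  also have "\<dots> = (\<integral>\<^sup>+n. ennreal (awgn_density v 0 n) * (\<integral>\<^sup>+y.
      ennreal (awgn_density v 0 ((y - of_real \<beta> * n) / of_real s) / s\<^sup>2) * indicator A y \<partial>lborel) \<partial>lborel)"
    unfolding inner unfolding noise_def by (subst nn_integral_density) simp_all
  also have "\<dots> = (\<integral>\<^sup>+n. \<integral>\<^sup>+y. ennreal (awgn_density v 0 n) *
      (ennreal (awgn_density v 0 ((y - of_real \<beta> * n) / of_real s) / s\<^sup>2) * indicator A y) \<partial>lborel \<partial>lborel)"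
    by (intro nn_integral_cong nn_integral_cmult[symmetric]) simp
  also have "\<dots> = (\<integral>\<^sup>+y. \<integral>\<^sup>+n. ennreal (awgn_density v 0 n) *
      (ennreal (awgn_density v 0 ((y - of_real \<beta> * n) / of_real s) / s\<^sup>2) * indicator A y) \<partial>lborel \<partial>lborel)"
    \<comment> \<open>After the exchange, n is the inner variable and can be integrated out for
      fixed y.\<close>
    by (rule lborel_pair.Fubini') simp
  also have "\<dots> = (\<integral>\<^sup>+y. \<integral>\<^sup>+n. ennreal (awgn_density v 0 y) * indicator A y
      * ennreal (awgn_density (s\<^sup>2 * v) (of_real \<beta> * y) n) \<partial>lborel \<partial>lborel)"
  proof (intro nn_integral_cong)
    fix y n :: complex
    have nonneg: "0 \<le> awgn_density v c x" "0 \<le> awgn_density (s\<^sup>2 * v) c x" for c x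
      using v by (simp_all add: awgn_density_def)
    have "ennreal (awgn_density v 0 n)
          * ennreal (awgn_density v 0 ((y - of_real \<beta> * n) / of_real s) / s\<^sup>2)
        = ennreal (awgn_density v 0 y) * ennreal (awgn_density (s\<^sup>2 * v) (of_real \<beta> * y) n)"
      using awgn_density_complete_square[OF v s unit, of n y] nonneg
      by (simp only: ennreal_mult[symmetric] divide_nonneg_nonneg zero_le_power2)
    then show "ennreal (awgn_density v 0 n) *
      (ennreal (awgn_density v 0 ((y - of_real \<beta> * n) / of_real s) / s\<^sup>2) * indicator A y)
      = ennreal (awgn_density v 0 y) * indicator A y * ennreal (awgn_density (s\<^sup>2 * v) (of_real \<beta> * y) n)"
      by (simp only: mult_ac)
  qed
  \<comment> \<open>The conditional density of n given y has total mass 1.\<close>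
  also have "\<dots> = (\<integral>\<^sup>+y. ennreal (awgn_density v 0 y) * indicator A y \<partial>lborel)"
    using v s by (simp add: nn_integral_cmult nn_integral_awgn_density)
  also have "\<dots> = emeasure (noise v) A"
    unfolding noise_def by (subst emeasure_density) simp_all
  finally show "emeasure (distr ?N borel ?g) A = emeasure (noise v) A" .
qed simp

section \<open>Degradation of a scaled constellation\<close>

text \<open>This is the coupling \<open>h\<close> for \<open>mutual_information_degraded_le\<close>;
  \<open>snd w\<close> is the fresh noise. It preserves the law of the sample space when \<beta>^2 +
  s^2 = 1 and s > 0.\<close>

definition mix_noise ::
    "real \<Rightarrow> real \<Rightarrow> (('h::finite, 'l::finite) label \<times> complex) \<times> complex \<Rightarrow> ('h, 'l) label \<times> complex" where
  "mix_noise \<beta> s w = (fst (fst w), of_real \<beta> * snd (fst w) + of_real s * snd w)"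

lemma mix_noise_measurable [measurable]:
  "mix_noise \<beta> s \<in> bicm_space v \<Otimes>\<^sub>M noise v \<rightarrow>\<^sub>M bicm_space v"
  unfolding mix_noise_def[abs_def] bicm_space_def by measurable

text \<open>The label is independent of both noises, so only the noise component matters, and there
  \<open>distr_noise_combination\<close> applies.\<close>

lemma distr_mix_noise:
  assumes v: "0 < v" and "0 < s" and "\<beta>\<^sup>2 + s\<^sup>2 = 1"
  shows "distr (bicm_space v \<Otimes>\<^sub>M noise v) (bicm_space v) (mix_noise \<beta> s)
    = (bicm_space v :: (('h::finite, 'l::finite) label \<times> complex) measure)"
proof -
  let ?L = "measure_pmf (pmf_of_set UNIV) :: ('h, 'l) label measure"
  have N: "prob_space (noise v)" using v by (rule prob_space_noise)
  have "distr (bicm_space v \<Otimes>\<^sub>M noise v) (?L \<Otimes>\<^sub>M borel) (mix_noise \<beta> s)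
      = ?L \<Otimes>\<^sub>M distr (noise v \<Otimes>\<^sub>M noise v) borel (\<lambda>w. of_real \<beta> * fst w + of_real s * snd w)"
    using pair_measure_distr_assoc[OF measure_pmf.prob_space_axioms N N,
        of "\<lambda>w. of_real \<beta> * fst w + of_real s * snd w" borel "pmf_of_set UNIV :: ('h, 'l) label pmf"]
    by (simp add: bicm_space_def mix_noise_def[abs_def])
  also have "\<dots> = bicm_space v"
    by (simp add: distr_noise_combination[OF assms] bicm_space_def)
  finally have "distr (bicm_space v \<Otimes>\<^sub>M noise v) (?L \<Otimes>\<^sub>M borel) (mix_noise \<beta> s) = bicm_space v" .
  moreover have "distr (bicm_space v \<Otimes>\<^sub>M noise v) (?L \<Otimes>\<^sub>M borel) (mix_noise \<beta> s)
      = distr (bicm_space v \<Otimes>\<^sub>M noise v) (bicm_space v) (mix_noise \<beta> s)"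
    by (intro distr_cong) (auto simp: bicm_space_def intro!: sets_pair_measure_cong)
  ultimately show ?thesis by simp
qed

text \<open>Regrouping \<beta> z + (\<beta> n + s n') as \<beta> (z + n) + s n' exhibits the
  degraded signal as a function of the original one and fresh noise, which is the hypothesis
  \<open>V_h\<close> of the degradation lemma.\<close>

lemma received_mix_noise:
  "received (\<beta> *\<^sub>R z) (mix_noise \<beta> s (\<omega>, n)) = of_real \<beta> * received z \<omega> + of_real s * n"
  by (simp add: received_def mix_noise_def) (simp add: scaleR_conv_of_real algebra_simps)

lemma bit_measurable [measurable]:
  "(\<lambda>\<omega>. high_bits \<omega> $ i) \<in> (bicm_space v :: (('h::finite, 'l::finite) label \<times> complex) measure)
    \<rightarrow>\<^sub>M count_space UNIV"
  "(\<lambda>\<omega>. low_bits \<omega> $ j) \<in> (bicm_space v :: (('h, 'l) label \<times> complex) measure)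
    \<rightarrow>\<^sub>M count_space UNIV"
  by (rule measurable_compose[OF bicm_random_variables(1)], simp)
    (rule measurable_compose[OF bicm_random_variables(2)], simp)

lemmas [measurable] = bicm_random_variables

lemma rates_scaleR_le:
  fixes z :: "('h::finite, 'l::finite) constellation"
  assumes v: "0 < v" and "0 \<le> \<beta>" and "\<beta> \<le> 1"
  shows "rate_H v (\<beta> *\<^sub>R z) \<le> rate_H v z" and "rate_L v (\<beta> *\<^sub>R z) \<le> rate_L v z"
proof -
  let ?M = "bicm_space v :: (('h, 'l) label \<times> complex) measure"
  interpret prob_space ?M using v by (rule prob_space_bicm_space)
  have "rate_H v (\<beta> *\<^sub>R z) \<le> rate_H v z \<and> rate_L v (\<beta> *\<^sub>R z) \<le> rate_L v z"
  \<comment> \<open>For \<beta> = 1 no noise would be added, so s = 0 and the change of variables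
    breaks down; the two constellations then coincide.\<close>
  proof (cases "\<beta> = 1")
    case False
    define s where "s = sqrt (1 - \<beta>\<^sup>2)"
    have "\<beta>\<^sup>2 < 1" using False assms(2,3) by (simp add: power_less_one_iff abs_square_less_1)
    then have s: "0 < s" "\<beta>\<^sup>2 + s\<^sup>2 = 1" by (simp_all add: s_def)
    note degraded = mutual_information_degraded_le[where b=2 and R="noise v" and h="mix_noise \<beta> s",
        OF _ prob_space_noise[OF v] _ _ _ _ mix_noise_measurable distr_mix_noise[OF v s]]
    have "mutual_information 2 (count_space UNIV) borel (\<lambda>\<omega>. high_bits \<omega> $ i) (received (\<beta> *\<^sub>R z))
        \<le> mutual_information 2 (count_space UNIV) borel (\<lambda>\<omega>. high_bits \<omega> $ i) (received z)" for i
      by (rule degraded[where g="\<lambda>w. of_real \<beta> * fst w + of_real s * snd w"])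
        (simp_all add: received_mix_noise, simp_all add: high_bits_def mix_noise_def)
    moreover have "mutual_information 2 (count_space UNIV) (borel \<Otimes>\<^sub>M count_space UNIV)
          (\<lambda>\<omega>. low_bits \<omega> $ j) (\<lambda>\<omega>. (received (\<beta> *\<^sub>R z) \<omega>, high_bits \<omega>))
        \<le> mutual_information 2 (count_space UNIV) (borel \<Otimes>\<^sub>M count_space UNIV)
          (\<lambda>\<omega>. low_bits \<omega> $ j) (\<lambda>\<omega>. (received z \<omega>, high_bits \<omega>))" for j
      \<comment> \<open>The observation is the pair of received signal and high-priority bits;
        \<open>g\<close> degrades the signal and passes the bits through, as
        \<open>mix_noise\<close> leaves the label alone.\<close>
      by (rule degraded[where g="\<lambda>w. (of_real \<beta> * fst (fst w) + of_real s * snd w, snd (fst w))"])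
        (simp_all add: received_mix_noise, simp_all add: high_bits_def low_bits_def mix_noise_def)
    ultimately show ?thesis
      unfolding rate_H_def rate_L_def conditional_mutual_information_def
      by (intro conjI sum_mono diff_right_mono)
  qed simp
  then show "rate_H v (\<beta> *\<^sub>R z) \<le> rate_H v z" and "rate_L v (\<beta> *\<^sub>R z) \<le> rate_L v z"
    by auto
qed

section \<open>Average power and rescaling\<close>

lemma avg_power_scaleR: "avg_power (c *\<^sub>R z) = c\<^sup>2 * avg_power z"
  by (simp add: avg_power_eq power_mult_distrib sum_distrib_left)

lemma avg_power_nonneg: "0 \<le> avg_power z"
  unfolding avg_power_eq by (intro divide_nonneg_nonneg sum_nonneg) auto

lemma avg_power_eq_0_iff: "avg_power z = 0 \<longleftrightarrow> z = 0"
  by (auto simp: avg_power_eq sum_nonneg_eq_0_iff vec_eq_iff)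

lemma constellation_of_power_exists:
  fixes z :: "('h::finite, 'l::finite) constellation"
  assumes p: "0 < p" and le: "avg_power z \<le> p"
  obtains z' :: "('h, 'l) constellation" and \<beta>
  where "avg_power z' = p" and "0 \<le> \<beta>" and "\<beta> \<le> 1" and "z = \<beta> *\<^sub>R z'"
proof (cases "z = 0")
  case True
  \<comment> \<open>The zero constellation cannot be scaled up, so a nonzero one is normalized to
    power \<open>p\<close> and multiplied by \<beta> = 0.\<close>
  define u :: "('h, 'l) constellation" where "u = (\<chi> b. 1)"
  have "u \<noteq> 0" by (simp add: u_def vec_eq_iff)
  then have pos: "0 < avg_power u"
    using avg_power_nonneg[of u] avg_power_eq_0_iff[of u] by simp
  then have "avg_power (sqrt (p / avg_power u) *\<^sub>R u) = p"
    using p by (simp add: avg_power_scaleR)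
  with True show thesis by (intro that[of _ 0]) auto
next
  case False
  then have pos: "0 < avg_power z"
    using avg_power_nonneg[of z] avg_power_eq_0_iff[of z] by simp
  show thesis
  \<comment> \<open>Power is quadratic in the scale, hence the square roots; \<beta> \<le> 1 is
    exactly the power constraint.\<close>
  proof (rule that[of "sqrt (p / avg_power z) *\<^sub>R z" "sqrt (avg_power z / p)"])
    show "avg_power (sqrt (p / avg_power z) *\<^sub>R z) = p"
      using p pos by (simp add: avg_power_scaleR)
    show "z = sqrt (avg_power z / p) *\<^sub>R sqrt (p / avg_power z) *\<^sub>R z"
      using p pos by (simp flip: real_sqrt_mult)
  qed (use p pos le in auto)
qed

section \<open>Equality of the two optimal values\<close>

theorem proposition1:
  fixes \<sigma>H2 \<sigma>L2 p r :: real
  assumes "0 < \<sigma>L2" and "\<sigma>L2 \<le> \<sigma>H2" and "p > 0" and "r \<ge> 0"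
  shows "(SUP z \<in> {z :: ('h::finite, 'l::finite) constellation.
              rate_H \<sigma>H2 z \<ge> r \<and> avg_power z \<le> p}. ereal (rate_L \<sigma>L2 z))
       = (SUP z \<in> {z :: ('h, 'l) constellation.
              rate_H \<sigma>H2 z \<ge> r \<and> avg_power z = p}. ereal (rate_L \<sigma>L2 z))"
proof (rule antisym)
  show "(SUP z \<in> {z :: ('h, 'l) constellation.
              rate_H \<sigma>H2 z \<ge> r \<and> avg_power z \<le> p}. ereal (rate_L \<sigma>L2 z))
      \<le> (SUP z \<in> {z :: ('h, 'l) constellation.
              rate_H \<sigma>H2 z \<ge> r \<and> avg_power z = p}. ereal (rate_L \<sigma>L2 z))"
  \<comment> \<open>In \<open>ereal\<close> the supremum of the empty set is -\<infinity>, so the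
    infeasible case is covered by the same comparison.\<close>
  proof (rule SUP_mono)
    fix z :: "('h, 'l) constellation"
    assume "z \<in> {z. rate_H \<sigma>H2 z \<ge> r \<and> avg_power z \<le> p}"
    then have rate: "r \<le> rate_H \<sigma>H2 z" and "avg_power z \<le> p" by auto
    from assms(3) this(2) obtain z' :: "('h, 'l) constellation" and \<beta>
      where z': "avg_power z' = p" and \<beta>: "0 \<le> \<beta>" "\<beta> \<le> 1" and z: "z = \<beta> *\<^sub>R z'"
      by (rule constellation_of_power_exists)
    \<comment> \<open>The same \<open>z'\<close> serves both receivers: monotonicity under scaling
      is used with \<sigma>H2 for feasibility and with \<sigma>L2 for the objective.\<close>
    have "r \<le> rate_H \<sigma>H2 z'"
      using rate rates_scaleR_le(1)[of \<sigma>H2 \<beta> z'] assms(1,2) \<beta> z by simp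
    moreover have "rate_L \<sigma>L2 z \<le> rate_L \<sigma>L2 z'"
      using rates_scaleR_le(2)[of \<sigma>L2 \<beta> z'] assms(1) \<beta> z by simp
    ultimately show "\<exists>z'\<in>{z :: ('h, 'l) constellation. rate_H \<sigma>H2 z \<ge> r \<and> avg_power z = p}.
        ereal (rate_L \<sigma>L2 z) \<le> ereal (rate_L \<sigma>L2 z')"
      using z' by auto
  qed
  show "(SUP z \<in> {z :: ('h, 'l) constellation.
              rate_H \<sigma>H2 z \<ge> r \<and> avg_power z = p}. ereal (rate_L \<sigma>L2 z))
      \<le> (SUP z \<in> {z :: ('h, 'l) constellation.
              rate_H \<sigma>H2 z \<ge> r \<and> avg_power z \<le> p}. ereal (rate_L \<sigma>L2 z))"
    by (rule SUP_subset_mono) auto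
qed

end
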